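(* Let $P\subset p\Sigma\subset\mathbb{R}^m$ be a convex integral polytope ($p$ a positive integer) such that $P\not\subset\partial(p\Sigma)$. Then the decay function $b_P$ is given by $$b_P(z)=\int_0^{\tau_z}\big[-q(e^{-\sigma/2}\cdot z)+p\,\mu(e^{-\sigma/2}\cdot z)\big]\cdot d\sigma,\qquad z\in(\mathbb{C}^* )^m\setminus\mathcal{A}_P,$$ where $\int_0^{\tau_z}$ denotes the line integral over any path in $\mathbb{R}^m$ from $0$ to $\tau_z$.
   Context: $\Sigma=\{x\in\mathbb{R}^m: x_j\ge 0,\ \sum_j x_j\le 1\}$; $\mathbb{C}^*=\mathbb{C}\setminus\{0\}$. A convex integral polytope is the convex hull of a finite set of points of $\mathbb{Z}^m$; $P^\circ$ is its interior in $\mathbb{R}^m$. $\mu(z)=\left(\frac{|z_1|^2}{1+\|z\|^2},\dots,\frac{|z_m|^2}{1+\|z\|^2}\right)$ on $(\mathbb{C}^* )^m$; $\mathcal{A}_P=\mu^{-1}(\frac1pP^\circ)$; $e^\sigma\cdot z=(e^{\sigma_1}z_1,\dots,e^{\sigma_m}z_m)$ for $\sigma\in\mathbb{R}^m$. For $x\in P$, $C_x=\{u\in\mathbb{R}^m:\langle u,x\rangle=\sup_{y\in P}\langle u,y\rangle\}$. For each $z\in(\mathbb{C}^* )^m$ there are unique $q(z)\in P$, $\tau_z\in C_{q(z)}$ with $p\mu(e^{-\tau_z/2}\cdot z)=q(z)$. The decay function is $b_P(z)=-\langle q(z),\tau_z\rangle+p\log\left(\frac{1+\|z\|^2}{1+\|e^{-\tau_z/2}\cdot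 z\|^2}\right)$. *)

theory Defs
  imports "HOL-Analysis.Analysis"
begin

definition std_simplex :: "(real ^ 'm) set" where
  "std_simplex = {x. (\<forall>j. 0 \<le> x $ j) \<and> (\<Sum>j\<in>UNIV. x $ j) \<le> 1}"

definition integral_polytope :: "(real ^ 'm) set \<Rightarrow> bool" where
  "integral_polytope P \<longleftrightarrow>
    (\<exists>V. finite V \<and> (\<forall>v\<in>V. \<forall>j. v $ j \<in> \<int>) \<and> P = convex hull V)"

definition complex_torus :: "(complex ^ 'm) set" where
  "complex_torus = {z. \<forall>j. z $ j \<noteq> 0}"

definition moment_map :: "complex ^ 'm \<Rightarrow> real ^ 'm" where
  "moment_map z = (\<chi> j. (cmod (z $ j))\<^sup>2 / (1 + (norm z)\<^sup>2))"

definition allowed_region :: "(real ^ 'm) set \<Rightarrow> nat \<Rightarrow> (complex ^ 'm) set" where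
  "allowed_region P p =
    {z \<in> complex_torus. moment_map z \<in> (\<lambda>x. (1 / real p) *\<^sub>R x) ` interior P}"

text \<open>The action \<open>e\<^sup>\<sigma> \<cdot> z\<close>; the point \<open>e\<^sup>-\<^sup>\<sigma>\<^sup>/\<^sup>2 \<cdot> z\<close> is \<open>exp_act (- (1/2) *\<^sub>R \<sigma>) z\<close>.\<close>

definition exp_act :: "real ^ 'm \<Rightarrow> complex ^ 'm \<Rightarrow> complex ^ 'm" where
  "exp_act \<sigma> z = (\<chi> j. complex_of_real (exp (\<sigma> $ j)) * z $ j)"

definition normal_cone :: "(real ^ 'm) set \<Rightarrow> real ^ 'm \<Rightarrow> (real ^ 'm) set" where
  "normal_cone P x = {u. u \<bullet> x = (SUP y\<in>P. u \<bullet> y)}"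

text \<open>The pair \<open>(q(z), \<tau>\<^sub>z)\<close>. Existence and uniqueness hold for every \<open>z\<close> in the torus when
  \<open>P \<subseteq> p\<Sigma>\<close> is a convex integral polytope not contained in the boundary of \<open>p\<Sigma>\<close>;
  otherwise the description may be improper.\<close>

definition q_tau :: "(real ^ 'm) set \<Rightarrow> nat \<Rightarrow> complex ^ 'm \<Rightarrow> (real ^ 'm) \<times> (real ^ 'm)" where
  "q_tau P p z = (THE (x, \<tau>). x \<in> P \<and> \<tau> \<in> normal_cone P x \<and>
     real p *\<^sub>R moment_map (exp_act (- (1/2) *\<^sub>R \<tau>) z) = x)"

definition q_point :: "(real ^ 'm) set \<Rightarrow> nat \<Rightarrow> complex ^ 'm \<Rightarrow> real ^ 'm" where
  "q_point P p z = fst (q_tau P p z)"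

definition tau_vec :: "(real ^ 'm) set \<Rightarrow> nat \<Rightarrow> complex ^ 'm \<Rightarrow> real ^ 'm" where
  "tau_vec P p z = snd (q_tau P p z)"

definition decay_function :: "(real ^ 'm) set \<Rightarrow> nat \<Rightarrow> complex ^ 'm \<Rightarrow> real" where
  "decay_function P p z =
     - (q_point P p z \<bullet> tau_vec P p z) +
     real p * ln ((1 + (norm z)\<^sup>2) /
                  (1 + (norm (exp_act (- (1/2) *\<^sub>R tau_vec P p z) z))\<^sup>2))"

text \<open>The line integral of a vector field \<open>F\<close> along a path \<open>\<gamma>\<close> parametrised by \<open>[0, 1]\<close>,
  the real analogue of \<open>has_contour_integral\<close>.\<close>

definition has_line_integral ::
  "('a \<Rightarrow> 'a) \<Rightarrow> real \<Rightarrow> (real \<Rightarrow> 'a::euclidean_space) \<Rightarrow> bool"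
  (infixr \<open>has'_line'_integral\<close> 50) where
  "(F has_line_integral I) \<gamma> \<longleftrightarrow>
     ((\<lambda>t. F (\<gamma> t) \<bullet> vector_derivative \<gamma> (at t within {0..1})) has_integral I) {0..1}"

end

theory Submission
  imports Defs
begin

text \<open>
  Put \<open>\<Phi>(\<sigma>) = p log (1 + \<parallel>e\<^sup>-\<^sup>\<sigma>\<^sup>/\<^sup>2 \<cdot> z\<parallel>\<^sup>2)\<close>, a strictly convex function with gradient
  \<open>- p \<mu>(e\<^sup>-\<^sup>\<sigma>\<^sup>/\<^sup>2 \<cdot> z)\<close>, and let \<open>h\<close> be the support function of \<open>P\<close>. The conditions defining
  \<open>(q(z), \<tau>\<^sub>z)\<close> say that \<open>\<tau>\<^sub>z\<close> minimises \<open>\<Phi> + h\<close>, which is coercive because \<open>P\<close> meets the interior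
  of \<open>p\<Sigma>\<close>. Hence the decay function at \<open>e\<^sup>-\<^sup>\<sigma>\<^sup>/\<^sup>2 \<cdot> z\<close> is \<open>\<Phi>(\<sigma>) - M(\<sigma>)\<close> with
  \<open>M(\<sigma>) = min\<^sub>\<tau> (\<Phi>(\<sigma> + \<tau>) + h(\<tau>))\<close>. The convex function \<open>M\<close> is touched from above at every \<open>\<sigma>\<close> by
  the smooth function \<open>\<Phi>(\<cdot> + \<tau>) + h(\<tau>)\<close> for the minimising \<open>\<tau>\<close>, so it is differentiable with
  gradient \<open>- q(e\<^sup>-\<^sup>\<sigma>\<^sup>/\<^sup>2 \<cdot> z)\<close>. The integrand is therefore minus the gradient of
  \<open>\<sigma> \<mapsto> b\<^sub>P(e\<^sup>-\<^sup>\<sigma>\<^sup>/\<^sup>2 \<cdot> z)\<close>, which vanishes at \<open>\<sigma> = \<tau>\<^sub>z\<close>.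
\<close>

section \<open>Calculus and convexity preliminaries\<close>

lemma has_derivative_touching:
  fixes f u :: "'a::real_normed_vector \<Rightarrow> real"
  assumes u: "(u has_derivative D) (at x)"
    and touch: "f x = u x" and le: "\<And>y. f y \<le> u y"
    and mid: "\<And>v. 2 * f x \<le> f (x + v) + f (x - v)"
  shows "(f has_derivative D) (at x)"
  unfolding has_derivative_at_alt
proof (intro conjI allI impI)
  show bl: "bounded_linear D"
    using u by (rule has_derivative_bounded_linear)
  fix e :: real
  assume "e > 0"
  then obtain d where d: "d > 0"
    "\<And>y. norm (y - x) < d \<Longrightarrow> \<bar>u y - u x - D (y - x)\<bar> \<le> e * norm (y - x)"
    using u unfolding has_derivative_at_alt real_norm_def by blast
  have "norm (f y - f x - D (y - x)) \<le> e * norm (y - x)" if y: "norm (y - x) < d" for y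
  proof -
    define v where "v = y - x"
    have "D (- v) = - D v"
      using bl by (simp add: bounded_linear.linear linear_neg)
    then have "\<bar>u (x - v) - u x + D v\<bar> \<le> e * norm v"
      using d(2)[of "x - v"] y by (simp add: v_def norm_minus_commute)
    moreover have "\<bar>u (x + v) - u x - D v\<bar> \<le> e * norm v"
      using d(2)[OF y] by (simp add: v_def)
    \<comment> \<open>The upper half comes from \<open>le\<close> at \<open>x + v\<close>. For the
      lower half, \<open>mid\<close> turns the upper bound at \<open>x - v\<close> into a lower
      bound for \<open>f\<close> at \<open>x + v\<close>.\<close>
    ultimately have "\<bar>f (x + v) - f x - D v\<bar> \<le> e * norm v"
      using le[of "x + v"] le[of "x - v"] mid[of v] touch by linarith
    then show ?thesis
      by (simp add: v_def)
  qed
  then show "\<exists>d>0. \<forall>y. norm (y - x) < d \<longrightarrow> norm (f y - f x - D (y - x)) \<le> e * norm (y - x)"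
    using d(1) by blast
qed

lemma one_plus_less_exp:
  fixes x :: real
  assumes "x \<noteq> 0"
  shows "1 + x < exp x"
proof -
  have "1 + x \<noteq> exp x"
    using ln_eq_minus_one[of "exp x"] assms by auto
  then show ?thesis
    using exp_ge_add_one_self[of x] by linarith
qed

section \<open>Support functions\<close>

definition support_function :: "'a::real_inner set \<Rightarrow> 'a \<Rightarrow> real" where
  "support_function P u = (SUP y\<in>P. u \<bullet> y)"

lemma normal_cone_iff: "u \<in> normal_cone P x \<longleftrightarrow> u \<bullet> x = support_function P u"
  by (simp add: normal_cone_def support_function_def)

lemma inner_le_support_function:
  fixes P :: "'a::real_inner set"
  assumes "bounded P" "y \<in> P"
  shows "u \<bullet> y \<le> support_function P u"
proof -
  obtain B where B: "\<And>y. y \<in> P \<Longrightarrow> norm y \<le> B"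
    using assms(1) by (auto simp: bounded_iff)
  have "u \<bullet> y \<le> norm u * B" if "y \<in> P" for y
    using norm_cauchy_schwarz[of u y] mult_left_mono[OF B[OF that], of "norm u"] by simp
  then have "bdd_above ((\<bullet>) u ` P)"
    by (auto intro!: bdd_aboveI2)
  then show ?thesis
    unfolding support_function_def using assms(2) by (intro cSUP_upper)
qed

lemma support_function_le:
  assumes "P \<noteq> {}" "\<And>y. y \<in> P \<Longrightarrow> u \<bullet> y \<le> c"
  shows "support_function P u \<le> c"
  unfolding support_function_def using assms by (rule cSUP_least)

lemma support_function_zero: "P \<noteq> {} \<Longrightarrow> support_function P 0 = 0"
  by (simp add: support_function_def)

lemma support_function_add_le:
  assumes "bounded P" "P \<noteq> {}"
  shows "support_function P (u + v) \<le> support_function P u + support_function P v"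
  using assms by (intro support_function_le)
    (auto simp: inner_add_left intro!: add_mono inner_le_support_function)

lemma support_function_scaleR_le:
  assumes "bounded P" "P \<noteq> {}" "0 \<le> c"
  shows "support_function P (c *\<^sub>R u) \<le> c * support_function P u"
  using assms by (intro support_function_le)
    (auto intro!: mult_left_mono inner_le_support_function)

lemma convex_on_support_function:
  assumes "bounded P" "P \<noteq> {}"
  shows "convex_on UNIV (support_function P)"
proof (rule convex_onI)
  fix t :: real and x y :: 'a
  assume "0 < t" "t < 1"
  then show "support_function P ((1 - t) *\<^sub>R x + t *\<^sub>R y)
      \<le> (1 - t) * support_function P x + t * support_function P y"
    using support_function_add_le[OF assms, of "(1 - t) *\<^sub>R x" "t *\<^sub>R y"]
      support_function_scaleR_le[OF assms, of "1 - t" x]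
      support_function_scaleR_le[OF assms, of t y] by linarith
qed simp

text \<open>A closed convex set is the intersection of its supporting half-spaces: a hyperplane
  separating \<open>x\<close> from \<open>P\<close> would violate \<open>le\<close> in its normal
  direction.\<close>

lemma mem_if_inner_le_support_function:
  fixes P :: "'a::euclidean_space set"
  assumes P: "compact P" "convex P" "P \<noteq> {}"
    and le: "\<And>v. v \<bullet> x \<le> support_function P v"
  shows "x \<in> P"
proof (rule ccontr)
  assume "x \<notin> P"
  then obtain a b where ab: "a \<bullet> x < b" "\<And>y. y \<in> P \<Longrightarrow> a \<bullet> y > b"
    using separating_hyperplane_closed_point[of P x] P compact_imp_closed by blast
  have "support_function P (- a) \<le> - b"
    using P(3) ab(2) by (intro support_function_le) (auto simp: less_imp_le)
  with le[of "- a"] ab(1) show False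
    by simp
qed

text \<open>The point found is a minimiser of \<open>\<Phi> + support_function P\<close>.\<close>

lemma exists_balanced_point:
  fixes P :: "'a::euclidean_space set" and \<Phi> :: "'a \<Rightarrow> real"
  assumes P: "compact P" "convex P" "P \<noteq> {}"
    and der: "\<And>\<tau>. (\<Phi> has_derivative (\<lambda>v. - (g \<tau> \<bullet> v))) (at \<tau>)"
    and r: "r > 0" and coercive: "\<And>\<tau>. r * norm \<tau> - c \<le> \<Phi> \<tau> + support_function P \<tau>"
  obtains \<tau> where "g \<tau> \<in> P" "\<tau> \<bullet> g \<tau> = support_function P \<tau>"
proof -
  let ?h = "support_function P"
  let ?F = "\<lambda>\<tau>. \<Phi> \<tau> + ?h \<tau>"
  have bP: "bounded P"
    using P(1) by (rule compact_imp_bounded)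
  have cvx: "convex_on UNIV ?h"
    using bP P(3) by (rule convex_on_support_function)
  have "continuous_on UNIV ?h"
    using convex_on_continuous[OF open_UNIV cvx] .
  moreover have "continuous_on UNIV \<Phi>"
    using der has_derivative_continuous continuous_at_imp_continuous_on by blast
  ultimately have cont: "continuous_on UNIV ?F"
    by (intro continuous_on_add)
  \<comment> \<open>Beyond this radius coercivity pushes \<open>?F\<close> above
    \<open>?F 0\<close>, so a minimiser on the ball is a global one; the maximum with 0 keeps the
    origin in the ball.\<close>
  define R where "R = max 0 ((?F 0 + c) / r)"
  have "\<exists>\<tau>\<in>cball 0 R. \<forall>\<rho>\<in>cball 0 R. ?F \<tau> \<le> ?F \<rho>"
    by (intro continuous_attains_inf compact_cball continuous_on_subset[OF cont])
      (auto simp: R_def)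
  then obtain \<tau> where "\<forall>\<rho>\<in>cball 0 R. ?F \<tau> \<le> ?F \<rho>"
    by blast
  then have \<tau>: "?F \<tau> \<le> ?F \<rho>" if "norm \<rho> \<le> R" for \<rho>
    using that by simp
  have min: "?F \<tau> \<le> ?F \<rho>" for \<rho>
  proof (cases "norm \<rho> \<le> R")
    case False
    then have "(?F 0 + c) / r < norm \<rho>"
      by (simp add: R_def)
    then have "?F 0 \<le> r * norm \<rho> - c"
      using r by (simp add: field_simps)
    also have "\<dots> \<le> ?F \<rho>"
      by (rule coercive)
    finally show ?thesis
      using \<tau>[of 0] by (simp add: R_def)
  qed (rule \<tau>)
  \<comment> \<open>First-order optimality: \<open>g \<tau>\<close>, minus the gradient of
    \<open>\<Phi>\<close>, is a subgradient of \<open>?h\<close> at the minimiser. Otherwise moving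
    a little along \<open>v\<close> lowers \<open>?F\<close>, because convexity bounds
    \<open>?h\<close> there by its chord of slope \<open>k\<close>.\<close>
  have dir: "v \<bullet> g \<tau> \<le> ?h (\<tau> + v) - ?h \<tau>" for v
  proof (rule ccontr)
    assume neg: "\<not> ?thesis"
    define k where "k = ?h (\<tau> + v) - ?h \<tau>"
    let ?f = "\<lambda>s::real. \<Phi> (\<tau> + s *\<^sub>R v) + s * k"
    have "((\<lambda>s. \<Phi> (\<tau> + s *\<^sub>R v)) has_derivative (\<lambda>s. - (g (\<tau> + 0 *\<^sub>R v) \<bullet> (s *\<^sub>R v)))) (at 0)"
      by (rule has_derivative_compose[OF _ der]) (auto intro!: derivative_eq_intros)
    then have "((\<lambda>s. \<Phi> (\<tau> + s *\<^sub>R v)) has_real_derivative - (v \<bullet> g \<tau>)) (at 0)"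
      unfolding has_field_derivative_def
      by (rule has_derivative_eq_rhs) (simp add: fun_eq_iff inner_commute)
    then have "(?f has_real_derivative - (v \<bullet> g \<tau>) + k) (at 0)"
      by (auto intro!: derivative_eq_intros)
    moreover have "- (v \<bullet> g \<tau>) + k < 0"
      using neg by (simp add: k_def)
    ultimately obtain d where d: "d > 0" "\<And>s. 0 < s \<Longrightarrow> s < d \<Longrightarrow> ?f (0 + s) < ?f 0"
      using DERIV_neg_dec_right[of ?f _ 0] by blast
    define s where "s = min (d / 2) 1"
    have s: "0 < s" "s < d" "s \<le> 1"
      using d(1) by (auto simp: s_def)
    have eq: "\<tau> + s *\<^sub>R v = (1 - s) *\<^sub>R \<tau> + s *\<^sub>R (\<tau> + v)"
      by (simp add: algebra_simps)
    have "?h (\<tau> + s *\<^sub>R v) \<le> (1 - s) * ?h \<tau> + s * ?h (\<tau> + v)"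
      unfolding eq using s by (intro convex_onD[OF cvx]) auto
    then have "?h (\<tau> + s *\<^sub>R v) \<le> ?h \<tau> + s * k"
      by (simp add: k_def algebra_simps)
    with d(2)[OF s(1,2)] min[of "\<tau> + s *\<^sub>R v"] show False
      by simp
  qed
  have mem: "g \<tau> \<in> P"
  proof (rule mem_if_inner_le_support_function[OF P])
    show "v \<bullet> g \<tau> \<le> ?h v" for v
      using dir[of v] support_function_add_le[OF bP P(3), of \<tau> v] by linarith
  qed
  \<comment> \<open>Direction \<open>- \<tau>\<close> ends at the origin, where \<open>?h\<close>
    vanishes; this gives the inequality opposite to membership in \<open>P\<close>.\<close>
  moreover have "\<tau> \<bullet> g \<tau> = ?h \<tau>"
    using dir[of "- \<tau>"] support_function_zero[OF P(3)] inner_le_support_function[OF bP mem, of \<tau>]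
    by simp
  ultimately show ?thesis
    using that by blast
qed

section \<open>The logarithmic potential\<close>

text \<open>Squared moduli of coordinates scale by \<open>exp (- \<sigma> $ j)\<close>, so the
  halving keeps stray factors out of the gradient of \<open>log_potential\<close>.\<close>

definition contract :: "real ^ 'm \<Rightarrow> complex ^ 'm \<Rightarrow> complex ^ 'm" where
  "contract \<sigma> z = exp_act (- (1/2) *\<^sub>R \<sigma>) z"

text \<open>On a torus point this is \<open>p\<close> times a log-sum-exp function of
  \<open>\<sigma>\<close>: the Fubini-Study potential in logarithmic coordinates.\<close>

definition log_potential :: "nat \<Rightarrow> complex ^ 'm \<Rightarrow> real ^ 'm \<Rightarrow> real" where
  "log_potential p z \<sigma> = real p * ln (1 + (norm (contract \<sigma> z))\<^sup>2)"

lemma contract_zero [simp]: "contract 0 z = z"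
  by (simp add: contract_def exp_act_def vec_eq_iff)

lemma contract_contract: "contract \<tau> (contract \<sigma> z) = contract (\<sigma> + \<tau>) z"
  by (simp add: contract_def exp_act_def vec_eq_iff algebra_simps mult_exp_exp flip: of_real_mult)

lemma contract_in_torus: "z \<in> complex_torus \<Longrightarrow> contract \<sigma> z \<in> complex_torus"
  by (simp add: complex_torus_def contract_def exp_act_def)

lemma norm_sq_vec: "(norm (z :: complex ^ 'm))\<^sup>2 = (\<Sum>j\<in>UNIV. (cmod (z $ j))\<^sup>2)"
  by (simp add: norm_vec_def L2_set_def sum_nonneg)

lemma cmod_sq_contract: "(cmod (contract \<sigma> z $ j))\<^sup>2 = exp (- \<sigma> $ j) * (cmod (z $ j))\<^sup>2"
proof -
  have "(exp (- (\<sigma> $ j / 2)))\<^sup>2 = exp (- \<sigma> $ j)"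
    by (simp add: power2_eq_square flip: exp_add)
  then show ?thesis
    by (simp add: contract_def exp_act_def norm_mult power_mult_distrib)
qed

lemma norm_sq_contract:
  "(norm (contract \<sigma> z))\<^sup>2 = (\<Sum>j\<in>UNIV. exp (- \<sigma> $ j) * (cmod (z $ j))\<^sup>2)"
  by (simp only: norm_sq_vec cmod_sq_contract)

lemma one_plus_norm_sq_pos: "0 < 1 + (norm x)\<^sup>2"
  by (simp add: add_pos_nonneg)

lemma moment_map_inner:
  "moment_map w \<bullet> v = (\<Sum>j\<in>UNIV. (cmod (w $ j))\<^sup>2 * v $ j) / (1 + (norm w)\<^sup>2)"
  by (simp add: moment_map_def inner_vec_def sum_divide_distrib)

lemma log_potential_contract: "log_potential p (contract \<sigma> z) \<tau> = log_potential p z (\<sigma> + \<tau>)"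
  by (simp only: log_potential_def contract_contract)

lemma has_derivative_log_potential:
  fixes z :: "complex ^ 'm" and \<sigma> :: "real ^ 'm"
  shows "(log_potential p z has_derivative (\<lambda>v. - ((real p *\<^sub>R moment_map (contract \<sigma> z)) \<bullet> v))) (at \<sigma>)"
proof -
  let ?S = "\<lambda>\<sigma> :: real ^ 'm. 1 + (\<Sum>j\<in>UNIV. exp (- \<sigma> $ j) * (cmod (z $ j))\<^sup>2)"
  have S: "?S \<sigma> = 1 + (norm (contract \<sigma> z))\<^sup>2"
    by (simp only: norm_sq_contract)
  have "(?S has_derivative (\<lambda>v. \<Sum>j\<in>UNIV. exp (- \<sigma> $ j) * - v $ j * (cmod (z $ j))\<^sup>2)) (at \<sigma>)"
    by (auto intro!: derivative_eq_intros bounded_linear.has_derivative[OF bounded_linear_vec_nth]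
        simp: fun_eq_iff mult_ac)
  then have "((\<lambda>\<sigma>. real p * ln (?S \<sigma>)) has_derivative (\<lambda>v. real p *
      ((\<Sum>j\<in>UNIV. exp (- \<sigma> $ j) * - v $ j * (cmod (z $ j))\<^sup>2) * inverse (?S \<sigma>)))) (at \<sigma>)"
    using one_plus_norm_sq_pos[of "contract \<sigma> z"] S
    by (intro has_derivative_mult_right has_derivative_ln) auto
  moreover have "(\<lambda>\<sigma>. real p * ln (?S \<sigma>)) = log_potential p z"
    by (simp add: log_potential_def norm_sq_contract fun_eq_iff)
  moreover have "real p * ((\<Sum>j\<in>UNIV. exp (- \<sigma> $ j) * - v $ j * (cmod (z $ j))\<^sup>2) * inverse (?S \<sigma>))
      = - ((real p *\<^sub>R moment_map (contract \<sigma> z)) \<bullet> v)" for v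
    unfolding S inner_scaleR_left moment_map_inner cmod_sq_contract
    by (simp add: divide_inverse sum_negf mult_ac)
  ultimately show ?thesis
    by simp
qed

text \<open>Strict convexity of log-sum-exp, by Jensen with weights 1 (exponent 0) and
  \<open>A j\<close> (exponent \<open>- d $ j\<close>). After exponentiation the claim is
  \<open>S < exp m * T\<close>, which follows termwise from \<open>1 + x < exp x\<close>.\<close>

lemma log_potential_above_tangent:
  assumes z: "z \<in> complex_torus" and p: "p > 0" and ne: "\<rho> \<noteq> \<tau>"
  shows "log_potential p z \<tau> - (real p *\<^sub>R moment_map (contract \<tau> z)) \<bullet> (\<rho> - \<tau>)
    < log_potential p z \<rho>"
proof -
  define A where "A j = exp (- \<tau> $ j) * (cmod (z $ j))\<^sup>2" for j
  define d where "d = \<rho> - \<tau>"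
  define S where "S = 1 + sum A UNIV"
  define T where "T = 1 + (\<Sum>j\<in>UNIV. A j * exp (- d $ j))"
  define m where "m = (\<Sum>j\<in>UNIV. A j * d $ j) / S"
  have A: "A j > 0" for j
    using z by (simp add: A_def complex_torus_def)
  have S: "S > 0"
    unfolding S_def using A by (intro add_pos_nonneg sum_nonneg) (auto simp: less_imp_le)
  have T: "T > 0"
    unfolding T_def using A by (intro add_pos_nonneg sum_nonneg) (auto simp: less_imp_le)
  have norm_\<tau>: "1 + (norm (contract \<tau> z))\<^sup>2 = S"
    by (simp add: norm_sq_contract S_def A_def)
  have "exp (- \<rho> $ j) = exp (- \<tau> $ j) * exp (- d $ j)" for j
    by (simp add: d_def flip: exp_add)
  then have norm_\<rho>: "1 + (norm (contract \<rho> z))\<^sup>2 = T"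
    by (simp add: norm_sq_contract T_def A_def mult_ac)
  have m: "moment_map (contract \<tau> z) \<bullet> d = m"
    unfolding moment_map_inner norm_\<tau> cmod_sq_contract by (simp add: m_def A_def)
  \<comment> \<open>Since \<open>m\<close> is the weighted mean of 0 and the \<open>d $ j\<close>,
    the added linear terms sum to zero.\<close>
  have "S = 1 + m + (\<Sum>j\<in>UNIV. A j * (1 + (m - d $ j)))"
  proof -
    have "S * m = (\<Sum>j\<in>UNIV. A j * d $ j)"
      using S by (simp add: m_def)
    then show ?thesis
      by (simp add: S_def sum.distrib sum_subtractf algebra_simps flip: sum_distrib_left sum_distrib_right)
  qed
  also have "\<dots> < exp m + (\<Sum>j\<in>UNIV. A j * exp (m - d $ j))"
  \<comment> \<open>Strictness comes from the constant term if \<open>m\<close> is nonzero, and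
    otherwise from a coordinate where \<open>d\<close> is nonzero; torus points have positive
    weights.\<close>
  proof (cases "m = 0")
    case True
    obtain k where "d $ k \<noteq> 0"
      using ne by (auto simp: d_def vec_eq_iff)
    then have "(\<Sum>j\<in>UNIV. A j * (1 + (m - d $ j))) < (\<Sum>j\<in>UNIV. A j * exp (m - d $ j))"
      using A True one_plus_less_exp[of "m - d $ k"]
      by (intro sum_strict_mono_ex1 ballI bexI[of _ k] mult_left_mono mult_strict_left_mono
          exp_ge_add_one_self) (auto simp: less_imp_le)
    then show ?thesis
      using True by simp
  next
    case False
    then show ?thesis
      using A by (intro add_less_le_mono one_plus_less_exp sum_mono mult_left_mono)
        (auto simp: less_imp_le exp_ge_add_one_self)
  qed
  also have "\<dots> = exp m * T"
    by (simp add: T_def algebra_simps exp_diff exp_minus sum_distrib_left divide_inverse)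
  finally have "ln S < m + ln T"
    using S T by (metis exp_gt_zero ln_exp ln_less_cancel_iff ln_mult_pos mult_pos_pos)
  then have "real p * (ln S - m) < real p * ln T"
    using p by (intro mult_strict_left_mono) auto
  then show ?thesis
    unfolding log_potential_def inner_scaleR_left norm_\<tau> norm_\<rho> m[unfolded d_def]
    by (simp add: algebra_simps)
qed

lemma log_potential_ge_tangent:
  assumes "z \<in> complex_torus" "p > 0"
  shows "log_potential p z \<tau> - (real p *\<^sub>R moment_map (contract \<tau> z)) \<bullet> (\<rho> - \<tau>)
    \<le> log_potential p z \<rho>"
  using log_potential_above_tangent[OF assms, of \<rho> \<tau>] by (cases "\<rho> = \<tau>") auto

lemma log_potential_midpoint:
  assumes "z \<in> complex_torus" "p > 0"
  shows "2 * log_potential p z ((1/2) *\<^sub>R (x + y)) \<le> log_potential p z x + log_potential p z y"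
proof -
  let ?m = "(1/2) *\<^sub>R (x + y)"
  let ?g = "real p *\<^sub>R moment_map (contract ?m z)"
  have "x - ?m = - (y - ?m)"
    by (simp add: vec_eq_iff field_simps)
  then have "?g \<bullet> (x - ?m) = - (?g \<bullet> (y - ?m))"
    by (simp only: inner_minus_right)
  then show ?thesis
    using log_potential_ge_tangent[OF assms, of ?m x] log_potential_ge_tangent[OF assms, of ?m y]
    by linarith
qed

text \<open>The logarithm dominates 0 and every
  \<open>ln ((cmod (z $ j))\<^sup>2) - \<tau> $ j\<close>, hence every combination with weights in
  the simplex. The constant term does not depend on \<open>y\<close>, which makes the bound uniform
  over a ball.\<close>

lemma log_potential_ge_simplex:
  assumes z: "z \<in> complex_torus" and y: "y \<in> (\<lambda>x. real p *\<^sub>R x) ` std_simplex"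
  shows "- real p * (\<Sum>j\<in>UNIV. \<bar>ln ((cmod (z $ j))\<^sup>2)\<bar>) - y \<bullet> \<tau> \<le> log_potential p z \<tau>"
proof -
  let ?a = "\<lambda>j. (cmod (z $ j))\<^sup>2"
  let ?C = "\<Sum>j\<in>UNIV. \<bar>ln (?a j)\<bar>"
  define L where "L = ln (1 + (norm (contract \<tau> z))\<^sup>2)"
  obtain s where s: "y = real p *\<^sub>R s" "\<And>j. 0 \<le> s $ j" "(\<Sum>j\<in>UNIV. s $ j) \<le> 1"
    using y by (auto simp: std_simplex_def)
  have "L \<ge> 0"
    by (simp add: L_def)
  have L: "ln (?a j) - \<tau> $ j \<le> L" for j
  proof -
    have pos: "?a j > 0"
      using z by (simp add: complex_torus_def)
    have "ln (?a j) - \<tau> $ j = ln (exp (- \<tau> $ j) * ?a j)"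
      using pos by (simp add: ln_mult)
    also have "exp (- \<tau> $ j) * ?a j \<le> (norm (contract \<tau> z))\<^sup>2"
      unfolding norm_sq_contract by (intro member_le_sum) auto
    then have "ln (exp (- \<tau> $ j) * ?a j) \<le> L"
      using pos one_plus_norm_sq_pos[of "contract \<tau> z"] unfolding L_def by (subst ln_le_cancel_iff) auto
    finally show ?thesis .
  qed
  have C: "- ?C \<le> ln (?a j)" for j
    using member_le_sum[of j UNIV "\<lambda>j. \<bar>ln (?a j)\<bar>"] by auto
  have "?C \<ge> 0"
    by (simp add: sum_nonneg)
  then have "- ?C \<le> (\<Sum>j\<in>UNIV. s $ j) * - ?C"
    using s(3) mult_right_mono[of "\<Sum>j\<in>UNIV. s $ j" 1 ?C] by simp
  also have "\<dots> \<le> (\<Sum>j\<in>UNIV. s $ j * ln (?a j))"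
    unfolding sum_distrib_right using C s(2) by (intro sum_mono mult_left_mono)
  also have "\<dots> = (\<Sum>j\<in>UNIV. s $ j * (ln (?a j) - \<tau> $ j)) + s \<bullet> \<tau>"
    by (simp add: inner_vec_def algebra_simps sum_subtractf)
  also have "(\<Sum>j\<in>UNIV. s $ j * (ln (?a j) - \<tau> $ j)) \<le> (\<Sum>j\<in>UNIV. s $ j) * L"
    unfolding sum_distrib_right using L s(2) by (intro sum_mono mult_left_mono)
  also have "\<dots> \<le> L"
    using s(3) \<open>L \<ge> 0\<close> mult_right_mono[of "\<Sum>j\<in>UNIV. s $ j" 1 L] by simp
  finally have "real p * (- ?C - s \<bullet> \<tau>) \<le> real p * L"
    by (intro mult_left_mono) auto
  then show ?thesis
    by (simp add: s(1) log_potential_def L_def algebra_simps)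
qed

lemma log_potential_plus_support_coercive:
  assumes z: "z \<in> complex_torus" and P: "bounded P" "x \<in> P"
    and x: "x \<in> interior ((\<lambda>x. real p *\<^sub>R x) ` std_simplex)"
  obtains r c where "r > 0" "\<And>\<tau>. r * norm \<tau> - c \<le> log_potential p z \<tau> + support_function P \<tau>"
proof -
  let ?c = "real p * (\<Sum>j\<in>UNIV. \<bar>ln ((cmod (z $ j))\<^sup>2)\<bar>)"
  obtain r where r: "r > 0" "cball x r \<subseteq> (\<lambda>x. real p *\<^sub>R x) ` std_simplex"
    using x by (auto simp: mem_interior_cball)
  have "r * norm \<tau> - ?c \<le> log_potential p z \<tau> + support_function P \<tau>" for \<tau>
  proof -
    \<comment> \<open>The point of the ball minimising the pairing with \<open>\<tau>\<close>: it
      yields the growth \<open>r * norm \<tau>\<close>, and the remaining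
      \<open>\<tau> \<bullet> x\<close> is absorbed by the support function.\<close>
    define y where "y = x - r *\<^sub>R sgn \<tau>"
    have "y \<in> cball x r"
      using r(1) by (simp add: y_def dist_norm norm_sgn)
    then have "- ?c - y \<bullet> \<tau> \<le> log_potential p z \<tau>"
      using log_potential_ge_simplex[OF z] r(2) by fastforce
    moreover have "sgn \<tau> \<bullet> \<tau> = norm \<tau>"
      by (cases "\<tau> = 0") (simp_all add: sgn_div_norm dot_square_norm power2_eq_square)
    then have "y \<bullet> \<tau> = \<tau> \<bullet> x - r * norm \<tau>"
      by (simp add: y_def inner_diff_left inner_commute[of x])
    ultimately show ?thesis
      using inner_le_support_function[OF P, of \<tau>] by linarith
  qed
  with r(1) show ?thesis
    using that by blast
qed

section \<open>The decay function as a potential\<close>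

locale decay_polytope =
  fixes P :: "(real ^ 'm) set" and p :: nat
  assumes compact: "compact P" and conv: "convex P" and p: "p > 0"
    and meets: "P \<inter> interior ((\<lambda>x. real p *\<^sub>R x) ` std_simplex) \<noteq> {}"
begin

lemma bounded: "bounded P"
  using compact by (rule compact_imp_bounded)

lemma nonempty: "P \<noteq> {}"
  using meets by blast

abbreviation balanced :: "complex ^ 'm \<Rightarrow> real ^ 'm \<Rightarrow> real ^ 'm \<Rightarrow> bool" where
  "balanced z x \<tau> \<equiv> x \<in> P \<and> \<tau> \<in> normal_cone P x \<and> real p *\<^sub>R moment_map (contract \<tau> z) = x"

lemma balanced_exists:
  assumes "z \<in> complex_torus"
  obtains x \<tau> where "balanced z x \<tau>"
proof -
  obtain x0 where x0: "x0 \<in> P" "x0 \<in> interior ((\<lambda>x. real p *\<^sub>R x) ` std_simplex)"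
    using meets by blast
  obtain r c where "r > 0"
    "\<And>\<tau>. r * norm \<tau> - c \<le> log_potential p z \<tau> + support_function P \<tau>"
    using log_potential_plus_support_coercive[OF assms bounded x0] by blast
  then show ?thesis
    using exists_balanced_point[OF compact conv nonempty has_derivative_log_potential[of p z]] that
    by (metis normal_cone_iff)
qed

text \<open>Adding the two strict tangent inequalities makes
  \<open>(x - x') \<bullet> (\<tau> - \<tau>')\<close> negative, while the normal cone conditions
  make it nonnegative.\<close>

lemma balanced_unique:
  assumes z: "z \<in> complex_torus" and b: "balanced z x \<tau>" "balanced z x' \<tau>'"
  shows "\<tau> = \<tau>'"
proof (rule ccontr)
  assume ne: "\<tau> \<noteq> \<tau>'"
  have x: "real p *\<^sub>R moment_map (contract \<tau> z) = x"
    and x': "real p *\<^sub>R moment_map (contract \<tau>' z) = x'"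
    using b by auto
  have "\<tau> \<bullet> x' \<le> \<tau> \<bullet> x" "\<tau>' \<bullet> x \<le> \<tau>' \<bullet> x'"
    using b inner_le_support_function[OF bounded, of x' \<tau>]
      inner_le_support_function[OF bounded, of x \<tau>'] by (simp_all add: normal_cone_iff)
  moreover have "log_potential p z \<tau> - x \<bullet> (\<tau>' - \<tau>) < log_potential p z \<tau>'"
    "log_potential p z \<tau>' - x' \<bullet> (\<tau> - \<tau>') < log_potential p z \<tau>"
    using log_potential_above_tangent[OF z p ne] log_potential_above_tangent[OF z p ne[symmetric]]
    unfolding x x' by simp_all
  ultimately show False
    by (simp add: inner_diff_right inner_commute)
qed

lemma q_tau_eqI:
  assumes "z \<in> complex_torus" "balanced z x \<tau>"
  shows "q_tau P p z = (x, \<tau>)"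
  unfolding q_tau_def contract_def[symmetric]
proof (rule the_equality)
  show "case (x, \<tau>) of (x, \<tau>) \<Rightarrow> balanced z x \<tau>"
    using assms(2) by simp
next
  fix y :: "(real ^ 'm) \<times> (real ^ 'm)"
  assume "case y of (x, \<tau>) \<Rightarrow> balanced z x \<tau>"
  then show "y = (x, \<tau>)"
    using balanced_unique[OF assms(1) _ assms(2)] assms(2) by (cases y) auto
qed

lemma balanced_q_tau:
  assumes "z \<in> complex_torus"
  shows "balanced z (q_point P p z) (tau_vec P p z)"
  using balanced_exists[OF assms] q_tau_eqI[OF assms]
  unfolding q_point_def tau_vec_def by (metis fst_conv snd_conv)

text \<open>After contracting by \<open>\<tau>\<^sub>z\<close> the scaled moment map already equals
  \<open>q(z)\<close>, and 0 lies in every normal cone.\<close>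

lemma tau_vec_contract_tau_vec:
  assumes z: "z \<in> complex_torus"
  shows "tau_vec P p (contract (tau_vec P p z) z) = 0"
proof -
  have "balanced (contract (tau_vec P p z) z) (q_point P p z) 0"
    using balanced_q_tau[OF z] by (simp add: normal_cone_iff support_function_zero nonempty)
  then show ?thesis
    using q_tau_eqI[OF contract_in_torus[OF z]] by (metis tau_vec_def snd_conv)
qed

text \<open>The infimal convolution of the potential and the support function, cf. \<open>reduced_le\<close>.\<close>

definition reduced :: "complex ^ 'm \<Rightarrow> real ^ 'm \<Rightarrow> real" where
  "reduced z \<sigma> = (let \<tau> = tau_vec P p (contract \<sigma> z)
     in log_potential p z (\<sigma> + \<tau>) + support_function P \<tau>)"

text \<open>At \<open>tau_vec\<close> the potential has slope \<open>- q\<close> and the support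
  function has subgradient \<open>q\<close>; in the sum of the two lower bounds the slopes
  cancel.\<close>

lemma reduced_le:
  assumes z: "z \<in> complex_torus"
  shows "reduced z \<sigma> \<le> log_potential p z (\<sigma> + \<rho>) + support_function P \<rho>"
proof -
  let ?w = "contract \<sigma> z"
  let ?q = "q_point P p ?w" and ?\<tau> = "tau_vec P p ?w"
  have w: "?w \<in> complex_torus"
    using z by (rule contract_in_torus)
  have b: "balanced ?w ?q ?\<tau>"
    using w by (rule balanced_q_tau)
  have "log_potential p ?w ?\<tau> - ?q \<bullet> (\<rho> - ?\<tau>) \<le> log_potential p ?w \<rho>"
    using log_potential_ge_tangent[OF w p, of ?\<tau> \<rho>] b by simp
  moreover have "\<rho> \<bullet> ?q \<le> support_function P \<rho>"
    using inner_le_support_function[OF bounded] b by blast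
  moreover have "?\<tau> \<bullet> ?q = support_function P ?\<tau>"
    using b by (simp add: normal_cone_iff)
  ultimately show ?thesis
    unfolding reduced_def Let_def log_potential_contract[symmetric]
    by (simp add: inner_diff_right inner_commute)
qed

text \<open>Partial minimisation preserves convexity: the midpoint of the minimisers at
  \<open>\<sigma> + v\<close> and \<open>\<sigma> - v\<close> is a competitor at
  \<open>\<sigma>\<close>.\<close>

lemma reduced_midpoint:
  assumes z: "z \<in> complex_torus"
  shows "2 * reduced z \<sigma> \<le> reduced z (\<sigma> + v) + reduced z (\<sigma> - v)"
proof -
  let ?h = "support_function P"
  define s where "s = tau_vec P p (contract (\<sigma> + v) z)"
  define t where "t = tau_vec P p (contract (\<sigma> - v) z)"
  let ?m = "(1/2) *\<^sub>R (s + t)"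
  have "\<sigma> + ?m = (1/2) *\<^sub>R ((\<sigma> + v + s) + (\<sigma> - v + t))"
    by (simp add: vec_eq_iff field_simps)
  then have "2 * log_potential p z (\<sigma> + ?m)
      \<le> log_potential p z (\<sigma> + v + s) + log_potential p z (\<sigma> - v + t)"
    using log_potential_midpoint[OF z p] by metis
  moreover have "2 * ?h ?m \<le> ?h s + ?h t"
    using support_function_scaleR_le[OF bounded nonempty, of "1/2" "s + t"]
      support_function_add_le[OF bounded nonempty, of s t] by simp
  ultimately show ?thesis
    using reduced_le[OF z, of \<sigma> ?m]
    unfolding reduced_def[of z "\<sigma> + v"] reduced_def[of z "\<sigma> - v"] Let_def s_def t_def by linarith
qed

text \<open>An envelope argument: freezing \<open>\<tau>\<close> at the minimiser for
  \<open>\<sigma>\<close> gives a smooth majorant touching there, so no regularity of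
  \<open>tau_vec\<close> in \<open>\<sigma>\<close> has to be established.\<close>

lemma has_derivative_reduced:
  assumes z: "z \<in> complex_torus"
  shows "(reduced z has_derivative (\<lambda>v. - (q_point P p (contract \<sigma> z) \<bullet> v))) (at \<sigma>)"
proof -
  define \<tau> where "\<tau> = tau_vec P p (contract \<sigma> z)"
  have q: "real p *\<^sub>R moment_map (contract (\<sigma> + \<tau>) z) = q_point P p (contract \<sigma> z)"
    using balanced_q_tau[OF contract_in_torus[OF z, of \<sigma>]]
    unfolding \<tau>_def contract_contract[symmetric] by blast
  have "((\<lambda>x. log_potential p z (x + \<tau>)) has_derivative
      (\<lambda>v. - ((real p *\<^sub>R moment_map (contract (\<sigma> + \<tau>) z)) \<bullet> v))) (at \<sigma>)"
    by (rule has_derivative_compose[OF _ has_derivative_log_potential])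
      (auto intro!: derivative_eq_intros)
  then have "((\<lambda>x. log_potential p z (x + \<tau>) + support_function P \<tau>) has_derivative
      (\<lambda>v. - (q_point P p (contract \<sigma> z) \<bullet> v))) (at \<sigma>)"
    unfolding q by (auto intro!: derivative_eq_intros)
  then show ?thesis
  proof (rule has_derivative_touching)
    show "reduced z \<sigma> = log_potential p z (\<sigma> + \<tau>) + support_function P \<tau>"
      by (simp add: reduced_def \<tau>_def Let_def)
  qed (use reduced_le[OF z] reduced_midpoint[OF z] in blast)+
qed

text \<open>The normal cone condition turns the pairing into the support function, and additivity of
  contractions turns the logarithm of the quotient into a difference of potentials.\<close>

lemma decay_function_contract:
  assumes z: "z \<in> complex_torus"
  shows "decay_function P p (contract \<sigma> z) = log_potential p z \<sigma> - reduced z \<sigma>"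
proof -
  let ?w = "contract \<sigma> z"
  let ?\<tau> = "tau_vec P p ?w"
  have "q_point P p ?w \<bullet> ?\<tau> = support_function P ?\<tau>"
    using balanced_q_tau[OF contract_in_torus[OF z]] by (simp add: normal_cone_iff inner_commute)
  moreover have "real p * ln ((1 + (norm ?w)\<^sup>2) / (1 + (norm (contract ?\<tau> ?w))\<^sup>2))
      = log_potential p z \<sigma> - log_potential p z (\<sigma> + ?\<tau>)"
    unfolding log_potential_def contract_contract
    by (subst ln_div) (simp_all add: one_plus_norm_sq_pos less_imp_neq[symmetric] right_diff_distrib)
  ultimately show ?thesis
    unfolding decay_function_def reduced_def Let_def contract_def[symmetric] by linarith
qed

lemma has_derivative_decay_function:
  assumes z: "z \<in> complex_torus"
  shows "((\<lambda>\<sigma>. decay_function P p (contract \<sigma> z)) has_derivative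
    (\<lambda>v. (q_point P p (contract \<sigma> z) - real p *\<^sub>R moment_map (contract \<sigma> z)) \<bullet> v)) (at \<sigma>)"
  unfolding decay_function_contract[OF z]
  by (rule has_derivative_eq_rhs[OF has_derivative_diff[OF has_derivative_log_potential
          has_derivative_reduced[OF z]]]) (simp add: inner_diff_left fun_eq_iff)

lemma decay_function_contract_tau_vec:
  assumes "z \<in> complex_torus"
  shows "decay_function P p (contract (tau_vec P p z) z) = 0"
  using one_plus_norm_sq_pos[of "contract (tau_vec P p z) z"]
  unfolding decay_function_def contract_def[symmetric]
  by (simp add: tau_vec_contract_tau_vec[OF assms])

end

section \<open>Line integrals of gradient fields\<close>

lemma has_line_integral_gradient:
  fixes f :: "'a::euclidean_space \<Rightarrow> real"
  assumes f: "\<And>x. (f has_derivative (\<lambda>v. F x \<bullet> v)) (at x)" and \<gamma>: "valid_path \<gamma>"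
  shows "(F has_line_integral (f (pathfinish \<gamma>) - f (pathstart \<gamma>))) \<gamma>"
proof -
  obtain S where S: "finite S" "\<gamma> C1_differentiable_on ({0..1} - S)"
    and cont: "continuous_on {0..1} \<gamma>"
    using \<gamma> by (auto simp: valid_path_def piecewise_C1_differentiable_on_def)
  have "((f \<circ> \<gamma>) has_vector_derivative F (\<gamma> t) \<bullet> vector_derivative \<gamma> (at t within {0..1})) (at t)"
    if t: "t \<in> {0..1} - S" for t
  proof -
    obtain D where D: "(\<gamma> has_vector_derivative D) (at t)"
      using S(2) t unfolding C1_differentiable_on_def by blast
    have "vector_derivative \<gamma> (at t within {0..1}) = D"
      using D t by (intro vector_derivative_at_within_ivl) auto
    then show ?thesis
      using vector_derivative_diff_chain_within[OF D has_derivative_at_withinI[OF f]] by simp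
  qed
  moreover have "continuous_on {0..1} (f \<circ> \<gamma>)"
  proof (rule continuous_on_compose[OF cont])
    show "continuous_on (\<gamma> ` {0..1}) f"
      using f has_derivative_continuous by (intro continuous_at_imp_continuous_on) blast
  qed
  \<comment> \<open>This form of the fundamental theorem tolerates the finite set \<open>S\<close>
    of corners of the path.\<close>
  ultimately have "((\<lambda>t. F (\<gamma> t) \<bullet> vector_derivative \<gamma> (at t within {0..1})) has_integral
      ((f \<circ> \<gamma>) 1 - (f \<circ> \<gamma>) 0)) {0..1}"
    by (rule fundamental_theorem_of_calculus_strong[OF S(1) zero_le_one])
  then show ?thesis
    by (simp add: has_line_integral_def pathfinish_def pathstart_def)
qed

theorem proposition5p3:
  fixes P :: "(real ^ 'm) set" and p :: nat and z :: "complex ^ 'm"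
    and \<gamma> :: "real \<Rightarrow> real ^ 'm"
  assumes "integral_polytope P"
    and "p > 0"
    and "P \<subseteq> (\<lambda>x. real p *\<^sub>R x) ` std_simplex"
    and "\<not> P \<subseteq> frontier ((\<lambda>x. real p *\<^sub>R x) ` std_simplex)"
    and "z \<in> complex_torus - allowed_region P p"
    and "valid_path \<gamma>" and "pathstart \<gamma> = 0" and "pathfinish \<gamma> = tau_vec P p z"
  shows "((\<lambda>\<sigma>. - q_point P p (exp_act (- (1/2) *\<^sub>R \<sigma>) z)
               + real p *\<^sub>R moment_map (exp_act (- (1/2) *\<^sub>R \<sigma>) z))
          has_line_integral decay_function P p z) \<gamma>"
proof -
  have z: "z \<in> complex_torus"
    using assms(5) by blast
  obtain V where "finite V" "P = convex hull V"
    using assms(1) by (auto simp: integral_polytope_def)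
  \<comment> \<open>A point of \<open>P\<close> off the frontier lies in the closure of the scaled
    simplex, hence in its interior.\<close>
  moreover have "P \<inter> interior ((\<lambda>x. real p *\<^sub>R x) ` std_simplex) \<noteq> {}"
    using assms(3,4) closure_subset unfolding frontier_def by blast
  ultimately interpret decay_polytope P p
    using assms(2) by unfold_locales (auto intro: compact_convex_hull finite_imp_compact)
  \<comment> \<open>The primitive is minus the decay function: it starts at
    \<open>- decay_function P p z\<close> and ends at 0, so its increment is the claimed
    value.\<close>
  have "((\<lambda>\<sigma>. - decay_function P p (contract \<sigma> z)) has_derivative
      (\<lambda>v. (- q_point P p (contract \<sigma> z) + real p *\<^sub>R moment_map (contract \<sigma> z)) \<bullet> v)) (at \<sigma>)" for \<sigma>
    by (rule has_derivative_eq_rhs[OF has_derivative_minus[OF has_derivative_decay_function[OF z]]])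
      (simp add: inner_diff_left inner_add_left fun_eq_iff)
  from has_line_integral_gradient[OF this assms(6)] show ?thesis
    unfolding contract_def[symmetric]
    by (simp add: assms(7,8) decay_function_contract_tau_vec[OF z])
qed

end
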